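(* There is a planar multigraph $G$ with $(\mathrm{ch}_{sep}(G),\mathrm{ch}_{ad}(G),\chi_{\nleftrightarrow}(G))=(3,3,4)$.
   Context: Multigraphs are finite and loopless, and may have several parallel edges between two vertices. $\mathrm{ch}_{sep}(G)$ (separation choosability) is the smallest $k$ such that for every assignment of lists $L(v)$ of $k$ colors to the vertices with $|L(x)\cap L(y)|\le 1$ for all adjacent $x,y$, there is a proper coloring $\varphi$ of $G$ with $\varphi(v)\in L(v)$ for all $v$. Given an edge coloring $f$ of $G$ (an arbitrary map from edges to colors, not necessarily proper), a vertex coloring $c$ (not necessarily proper) is adapted to $f$ if no edge $e$ with ends $x,y$ satisfies $c(x)=c(y)=f(e)$. $\mathrm{ch}_{ad}(G)$ (adaptable choosability) is the smallest $k$ such that for every edge coloring $f$ and every assignment of lists $L(v)$ of $k$ colors to the vertices, there is a coloring $c$ adapted to $f$ with $c(v)\in L(v)$ for all $v$. A local $k$-partition of $G$ is a collection $\{c_v\}_{v\in V(G)}$ of maps $c_v : E(v)\to\{1,\dots,k\}$, where $E(v)$ is the set of edges incident with $v$. $G$ is conflict $\{c_v\}$-colorable if there is a map $\varphi : V(G)\to\{1,\dots,k\}$ such that no edge $e$ with ends $x,y$ satisfies both $\varphi(x)=c_x(e)$ and $\varphi(y)=c_y(e)$. $\chi_{\nleftrightarrow}(G)$ (single conflict chromatic number) is the smallest $k$ such that $G$ is conflict $\{c_v\}$-colorable for every local $k$-partition. *)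

theory Defs
  imports "HOL-Analysis.Analysis"
begin

record ('v, 'e) mgraph =
  verts :: "'v set"
  edges :: "'e set"
  ends :: "'e \<Rightarrow> 'v set"

text \<open>Finite and loopless; parallel edges are distinct edges with the same set of ends.\<close>

definition multigraph :: "('v, 'e) mgraph \<Rightarrow> bool" where
  "multigraph G \<longleftrightarrow> finite (verts G) \<and> finite (edges G) \<and>
     (\<forall>e\<in>edges G. ends G e \<subseteq> verts G \<and> card (ends G e) = 2)"

definition adjacent :: "('v, 'e) mgraph \<Rightarrow> 'v \<Rightarrow> 'v \<Rightarrow> bool" where
  "adjacent G x y \<longleftrightarrow> (\<exists>e\<in>edges G. ends G e = {x, y})"

definition incident_edges :: "('v, 'e) mgraph \<Rightarrow> 'v \<Rightarrow> 'e set" where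
  "incident_edges G v = {e \<in> edges G. v \<in> ends G e}"

text \<open>The plane is represented by the type of complex numbers. Edges, parallel ones included,
  are drawn as arcs (injective paths, up to and including their end points).\<close>

definition plane_drawing ::
  "('v, 'e) mgraph \<Rightarrow> ('v \<Rightarrow> complex) \<Rightarrow> ('e \<Rightarrow> real \<Rightarrow> complex) \<Rightarrow> bool" where
  "plane_drawing G p \<gamma> \<longleftrightarrow>
     inj_on p (verts G) \<and>
     (\<forall>e\<in>edges G. arc (\<gamma> e) \<and> {pathstart (\<gamma> e), pathfinish (\<gamma> e)} = p ` ends G e \<and>
        path_image (\<gamma> e) \<inter> p ` verts G = p ` ends G e) \<and>
     (\<forall>e\<in>edges G. \<forall>e'\<in>edges G. e \<noteq> e' \<longrightarrow>
        path_image (\<gamma> e) \<inter> path_image (\<gamma> e') = p ` (ends G e \<inter> ends G e'))"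

definition planar :: "('v, 'e) mgraph \<Rightarrow> bool" where
  "planar G \<longleftrightarrow> (\<exists>p \<gamma>. plane_drawing G p \<gamma>)"

text \<open>Colors are natural numbers; for finite graphs and finite lists this loses no generality.
  The finiteness requirement matters because infinite sets have cardinality 0.\<close>

definition list_assignment :: "('v, 'e) mgraph \<Rightarrow> nat \<Rightarrow> ('v \<Rightarrow> nat set) \<Rightarrow> bool" where
  "list_assignment G k L \<longleftrightarrow> (\<forall>v\<in>verts G. finite (L v) \<and> card (L v) = k)"

definition list_respecting :: "('v, 'e) mgraph \<Rightarrow> ('v \<Rightarrow> nat set) \<Rightarrow> ('v \<Rightarrow> nat) \<Rightarrow> bool" where
  "list_respecting G L \<phi> \<longleftrightarrow> (\<forall>v\<in>verts G. \<phi> v \<in> L v)"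

definition separated :: "('v, 'e) mgraph \<Rightarrow> ('v \<Rightarrow> nat set) \<Rightarrow> bool" where
  "separated G L \<longleftrightarrow> (\<forall>x y. adjacent G x y \<longrightarrow> card (L x \<inter> L y) \<le> 1)"

definition proper_coloring :: "('v, 'e) mgraph \<Rightarrow> ('v \<Rightarrow> nat) \<Rightarrow> bool" where
  "proper_coloring G \<phi> \<longleftrightarrow> (\<forall>x y. adjacent G x y \<longrightarrow> \<phi> x \<noteq> \<phi> y)"

definition ch_sep :: "('v, 'e) mgraph \<Rightarrow> nat" where
  "ch_sep G = (LEAST k. \<forall>L. list_assignment G k L \<and> separated G L \<longrightarrow>
     (\<exists>\<phi>. proper_coloring G \<phi> \<and> list_respecting G L \<phi>))"

definition adapted :: "('v, 'e) mgraph \<Rightarrow> ('e \<Rightarrow> nat) \<Rightarrow> ('v \<Rightarrow> nat) \<Rightarrow> bool" where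
  "adapted G f c \<longleftrightarrow>
     \<not> (\<exists>e\<in>edges G. \<exists>x y. ends G e = {x, y} \<and> c x = c y \<and> c y = f e)"

definition ch_ad :: "('v, 'e) mgraph \<Rightarrow> nat" where
  "ch_ad G = (LEAST k. \<forall>f L. list_assignment G k L \<longrightarrow>
     (\<exists>c. adapted G f c \<and> list_respecting G L c))"

definition local_partition :: "('v, 'e) mgraph \<Rightarrow> nat \<Rightarrow> ('v \<Rightarrow> 'e \<Rightarrow> nat) \<Rightarrow> bool" where
  "local_partition G k c \<longleftrightarrow> (\<forall>v\<in>verts G. \<forall>e\<in>incident_edges G v. c v e \<in> {1..k})"

definition conflict_colorable :: "('v, 'e) mgraph \<Rightarrow> nat \<Rightarrow> ('v \<Rightarrow> 'e \<Rightarrow> nat) \<Rightarrow> bool" where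
  "conflict_colorable G k c \<longleftrightarrow> (\<exists>\<phi>. (\<forall>v\<in>verts G. \<phi> v \<in> {1..k}) \<and>
     \<not> (\<exists>e\<in>edges G. \<exists>x y. ends G e = {x, y} \<and> \<phi> x = c x e \<and> \<phi> y = c y e))"

text \<open>The restriction to positive \<open>k\<close> is essential: a graph with an edge has no local
  0-partition, so \<open>k = 0\<close> would satisfy the condition vacuously.\<close>

definition single_conflict_chromatic_number :: "('v, 'e) mgraph \<Rightarrow> nat" where
  "single_conflict_chromatic_number G = (LEAST k. k \<ge> 1 \<and>
     (\<forall>c. local_partition G k c \<longrightarrow> conflict_colorable G k c))"

end

theory Submission imports Defs
begin

text \<open>Two 4-cycles sharing a vertex form a planar 2-degenerate graph, hence a 3-choosable one. It
  is not separation 2-choosable: either of the two colors of the shared vertex \<open>0\<close> is refuted by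
  the implications along one of the cycles. Multiplying the edge between \<open>0\<close> and \<open>1\<close> by 9 affects
  neither \<open>ch_sep\<close> nor \<open>ch_ad\<close>, because a proper coloring is adapted to everything. However, nine
  parallel edges can forbid all \<open>3 \<times> 3\<close> pairs of colors at their ends, but not all \<open>4 \<times> 4\<close> pairs,
  and every other vertex is greedily conflict-colorable from four colors.\<close>

section \<open>Comparison of choosability, adaptable choosability and separation
  choosability\<close>

definition choosable :: "('v, 'e) mgraph \<Rightarrow> nat \<Rightarrow> bool" where
  "choosable G k \<longleftrightarrow> (\<forall>L. list_assignment G k L \<longrightarrow>
     (\<exists>\<phi>. proper_coloring G \<phi> \<and> list_respecting G L \<phi>))"

definition sep_choosable :: "('v, 'e) mgraph \<Rightarrow> nat \<Rightarrow> bool" where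
  "sep_choosable G k \<longleftrightarrow> (\<forall>L. list_assignment G k L \<and> separated G L \<longrightarrow>
     (\<exists>\<phi>. proper_coloring G \<phi> \<and> list_respecting G L \<phi>))"

definition ad_choosable :: "('v, 'e) mgraph \<Rightarrow> nat \<Rightarrow> bool" where
  "ad_choosable G k \<longleftrightarrow> (\<forall>f L. list_assignment G k L \<longrightarrow>
     (\<exists>c. adapted G f c \<and> list_respecting G L c))"

lemma proper_coloring_adapted: "proper_coloring G c \<Longrightarrow> adapted G f c"
  unfolding proper_coloring_def adapted_def adjacent_def by blast

lemma choosable_imp_ad_choosable: "choosable G k \<Longrightarrow> ad_choosable G k"
  unfolding choosable_def ad_choosable_def using proper_coloring_adapted by blast

text \<open>Separated lists at adjacent vertices share at most one color. If every edge is given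
  that color, an adapted coloring from the lists is proper.\<close>

lemma ad_choosable_imp_sep_choosable:
  assumes "multigraph G" and ad: "ad_choosable G k"
  shows "sep_choosable G k"
  unfolding sep_choosable_def
proof (intro allI impI)
  fix L assume L: "list_assignment G k L \<and> separated G L"
  \<comment> \<open>When the ends have no common color the choice is arbitrary. This is harmless, as
    such ends cannot receive equal colors anyway.\<close>
  define f where "f e = (SOME a. \<forall>v\<in>ends G e. a \<in> L v)" for e
  obtain c where c: "adapted G f c" "list_respecting G L c"
    using ad L unfolding ad_choosable_def by blast
  have "c x \<noteq> c y" if adj: "adjacent G x y" for x y
  proof
    assume eq: "c x = c y"
    from adj obtain e where e: "e \<in> edges G" "ends G e = {x, y}"
      unfolding adjacent_def by blast
    then have xy: "x \<in> verts G" "y \<in> verts G"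
      using assms(1) unfolding multigraph_def by auto
    then have c_in: "c x \<in> L x \<inter> L y"
      using c(2) eq unfolding list_respecting_def by auto
    then have "\<forall>v\<in>ends G e. c x \<in> L v"
      using e by auto
    then have "\<forall>v\<in>ends G e. f e \<in> L v"
      unfolding f_def by (rule someI)
    then have "f e \<in> L x \<inter> L y"
      using e by auto
    moreover have "card (L x \<inter> L y) \<le> Suc 0" "finite (L x \<inter> L y)"
      using L adj xy unfolding separated_def list_assignment_def by auto
    ultimately have "f e = c x"
      using c_in by (simp add: card_le_Suc0_iff_eq)
    then show False
      using c(1) e eq unfolding adapted_def by fastforce
  qed
  then show "\<exists>\<phi>. proper_coloring G \<phi> \<and> list_respecting G L \<phi>"
    using c(2) unfolding proper_coloring_def by blast
qed

text \<open>Both parameters are squeezed: \<open>choosable\<close> implies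
  \<open>ad_choosable\<close>, which implies \<open>sep_choosable\<close>, so an upper bound at the
  first and a lower bound at the last determine them.\<close>

lemma ch_sep_ch_ad_eqI:
  assumes "multigraph G" "choosable G k" and "\<And>j. j < k \<Longrightarrow> \<not> sep_choosable G j"
  shows "ch_sep G = k" "ch_ad G = k"
proof -
  have ad: "ad_choosable G k"
    using assms(2) by (rule choosable_imp_ad_choosable)
  have lower: "k \<le> j" if "sep_choosable G j" for j
    using assms(3) that not_le by blast
  show "ch_sep G = k"
    unfolding ch_sep_def sep_choosable_def[symmetric]
    using ad_choosable_imp_sep_choosable[OF assms(1) ad] lower by (rule Least_equality)
  show "ch_ad G = k"
    unfolding ch_ad_def ad_choosable_def[symmetric]
    using ad lower ad_choosable_imp_sep_choosable[OF assms(1)] by (intro Least_equality) auto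
qed

lemma ex_avoiding:
  assumes "card A \<ge> 3"
  shows "\<exists>c\<in>A. c \<noteq> a \<and> c \<noteq> b"
proof (rule ccontr)
  assume "\<not> ?thesis"
  then have "A \<subseteq> {a, b}" by blast
  then have "card A \<le> card {a, b}" by (intro card_mono) auto
  also have "\<dots> \<le> 2" by (simp add: card_insert_if)
  finally show False using assms by simp
qed

section \<open>The multigraph of two squares\<close>

text \<open>The index \<open>j\<close> ranges over the eight edges of the underlying simple graph. In the multigraph
  the edge \<open>e\<close> lies over the index \<open>e - 8\<close>; by truncation the nine edges \<open>0, \<dots>, 8\<close> lie over \<open>0\<close>.\<close>

definition src :: "nat \<Rightarrow> nat" where
  "src j = [0, 1, 2, 3, 0, 4, 5, 6] ! j"

definition tgt :: "nat \<Rightarrow> nat" where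
  "tgt j = [1, 2, 3, 0, 4, 5, 6, 0] ! j"

definition two_squares :: "(nat, nat) mgraph" where
  "two_squares = \<lparr>verts = {..<7}, edges = {..<16}, ends = (\<lambda>e. {src (e - 8), tgt (e - 8)})\<rparr>"

lemma two_squares_simps [simp]:
  "verts two_squares = {..<7}" "edges two_squares = {..<16}"
  "ends two_squares e = {src (e - 8), tgt (e - 8)}"
  by (simp_all add: two_squares_def)

lemma src_tgt_simps [simp]:
  "src 0 = 0" "src (Suc 0) = 1" "src 1 = 1" "src 2 = 2" "src 3 = 3"
  "src 4 = 0" "src 5 = 4" "src 6 = 5" "src 7 = 6"
  "tgt 0 = 1" "tgt (Suc 0) = 2" "tgt 1 = 2" "tgt 2 = 3" "tgt 3 = 0"
  "tgt 4 = 4" "tgt 5 = 5" "tgt 6 = 6" "tgt 7 = 0"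
  by (simp_all add: src_def tgt_def)

lemma all_less_7: "(\<forall>v<7. P v) \<longleftrightarrow> P 0 \<and> P 1 \<and> P 2 \<and> P 3 \<and> P 4 \<and> P 5 \<and> P (6::nat)"
  by (simp add: numeral_eq_Suc All_less_Suc conj_ac)

lemma all_less_8:
  "(\<forall>j<8. P j) \<longleftrightarrow> P 0 \<and> P 1 \<and> P 2 \<and> P 3 \<and> P 4 \<and> P 5 \<and> P 6 \<and> P (7::nat)"
  by (simp add: numeral_eq_Suc All_less_Suc conj_ac)

lemma less_8_cases:
  assumes "(j::nat) < 8"
  obtains "j = 0" | "j = 1" | "j = 2" | "j = 3" | "j = 4" | "j = 5" | "j = 6" | "j = 7"
  using assms by linarith

text \<open>Truncated subtraction maps the sixteen edges onto the eight indices, so conditions on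
  ends alone become eight checks.\<close>

lemma two_squares_all_edges:
  "(\<forall>e\<in>edges two_squares. P (e - 8)) \<longleftrightarrow> (\<forall>j<8. P j)"
proof (intro iffI allI impI)
  fix j :: nat assume "\<forall>e\<in>edges two_squares. P (e - 8)" "j < 8"
  moreover from this have "j + 8 \<in> edges two_squares" by simp
  ultimately show "P j" by fastforce
qed auto

lemma adjacent_two_squares:
  "adjacent two_squares x y \<longleftrightarrow> (\<exists>j<8. {x, y} = {src j, tgt j})"
  using two_squares_all_edges[of "\<lambda>j. {x, y} \<noteq> {src j, tgt j}"]
  unfolding adjacent_def by auto

lemma multigraph_two_squares: "multigraph two_squares"
proof -
  have "\<forall>j<8. {src j, tgt j} \<subseteq> {..<7} \<and> card {src j, tgt j} = 2"
    unfolding all_less_8 by simp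
  then show ?thesis
    using two_squares_all_edges[of "\<lambda>j. {src j, tgt j} \<subseteq> {..<7} \<and> card {src j, tgt j} = 2"]
    by (simp add: multigraph_def)
qed

lemma proper_coloring_two_squares:
  "proper_coloring two_squares \<phi> \<longleftrightarrow> (\<forall>j<8. \<phi> (src j) \<noteq> \<phi> (tgt j))"
  unfolding proper_coloring_def adjacent_two_squares by (auto simp: doubleton_eq_iff)

lemma separated_two_squares:
  "separated two_squares L \<longleftrightarrow> (\<forall>j<8. card (L (src j) \<inter> L (tgt j)) \<le> 1)"
  unfolding separated_def adjacent_two_squares by (auto simp: doubleton_eq_iff Int_commute)

section \<open>List colorings of the two squares\<close>

lemma choosable_two_squares: "choosable two_squares 3"
  unfolding choosable_def
proof (intro allI impI)
  fix L assume "list_assignment two_squares 3 L"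
  then have "card (L v) \<ge> 3" if "v < 7" for v
    using that by (simp add: list_assignment_def)
  then have ex: "\<exists>c\<in>L v. c \<noteq> a \<and> c \<noteq> b" if "v < 7" for v a b
    using that by (intro ex_avoiding) auto
  \<comment> \<open>In the order 0, 1, 3, 2, 4, 6, 5 every vertex has at most two earlier
    neighbors.\<close>
  obtain c0 where c0: "c0 \<in> L 0" using ex[of 0] by auto
  obtain c1 where c1: "c1 \<in> L 1" "c1 \<noteq> c0" using ex[of 1 c0] by auto
  obtain c3 where c3: "c3 \<in> L 3" "c3 \<noteq> c0" using ex[of 3 c0] by auto
  obtain c2 where c2: "c2 \<in> L 2" "c2 \<noteq> c1" "c2 \<noteq> c3" using ex[of 2 c1 c3] by auto
  obtain c4 where c4: "c4 \<in> L 4" "c4 \<noteq> c0" using ex[of 4 c0] by auto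
  obtain c6 where c6: "c6 \<in> L 6" "c6 \<noteq> c0" using ex[of 6 c0] by auto
  obtain c5 where c5: "c5 \<in> L 5" "c5 \<noteq> c4" "c5 \<noteq> c6" using ex[of 5 c4 c6] by auto
  define \<phi> where "\<phi> = (!) [c0, c1, c2, c3, c4, c5, c6]"
  have "proper_coloring two_squares \<phi>"
    using c1 c2 c3 c4 c5 c6 unfolding proper_coloring_two_squares all_less_8
    by (simp add: \<phi>_def)
  moreover have "\<forall>v<7. \<phi> v \<in> L v"
    using c0 c1 c2 c3 c4 c5 c6 unfolding all_less_7 by (simp add: \<phi>_def)
  ultimately show "\<exists>\<phi>. proper_coloring two_squares \<phi> \<and> list_respecting two_squares L \<phi>"
    by (auto simp: list_respecting_def)
qed

lemma not_sep_choosable_two_squares: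
  assumes "k < 3"
  shows "\<not> sep_choosable two_squares k"
proof (cases "k = 2")
  case True
  \<comment> \<open>Color 0 at vertex 0 forces 2 at vertex 1 and 3 at vertex 3, which exhausts the
    list of vertex 2. Color 1 does the same to vertex 5 through vertices 4 and 6.\<close>
  define L :: "nat \<Rightarrow> nat set"
    where "L = (!) [{0, 1}, {0, 2}, {2, 3}, {0, 3}, {1, 2}, {2, 3}, {1, 3}]"
  have "\<forall>v<7. finite (L v) \<and> card (L v) = 2"
    unfolding all_less_7 by (simp add: L_def)
  then have "list_assignment two_squares k L"
    using True by (simp add: list_assignment_def)
  moreover have "separated two_squares L"
    unfolding separated_two_squares all_less_8 by (simp add: L_def)
  moreover have False if "proper_coloring two_squares \<phi>" "list_respecting two_squares L \<phi>" for \<phi>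
  proof -
    have "\<forall>v<7. \<phi> v \<in> L v"
      using that(2) by (simp add: list_respecting_def)
    then show False
      using that(1) unfolding proper_coloring_two_squares all_less_7 all_less_8
      by (simp add: L_def) metis
  qed
  ultimately show ?thesis
    unfolding sep_choosable_def by blast
next
  case False
  with assms have k: "k \<le> 1" by simp
  \<comment> \<open>Equal lists of size at most 1 are separated; they are either empty or give all
    vertices the same color.\<close>
  have "list_assignment two_squares k (\<lambda>_. {..<k})"
    by (simp add: list_assignment_def)
  moreover have "separated two_squares (\<lambda>_. {..<k})"
    using k by (simp add: separated_def)
  moreover have False
    if "proper_coloring two_squares \<phi>" "list_respecting two_squares (\<lambda>_. {..<k}) \<phi>" for \<phi>
  proof -
    have "\<phi> 0 < k" "\<phi> 1 < k"
      using that(2) by (auto simp: list_respecting_def)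
    with k have "\<phi> 0 = \<phi> 1" by simp
    then show False
      using that(1) unfolding proper_coloring_two_squares all_less_8 by simp
  qed
  ultimately show ?thesis
    unfolding sep_choosable_def by blast
qed

section \<open>Single conflict colorings of the two squares\<close>

lemma not_conflict_colorable_two_squares:
  assumes "1 \<le> k" "k \<le> 3"
  shows "\<exists>c. local_partition two_squares k c \<and> \<not> conflict_colorable two_squares k c"
proof (intro exI conjI)
  \<comment> \<open>The two base-3 digits of \<open>e < 9\<close>, shifted by 1, run through all
    pairs of colors at the vertices 0 and 1. Taking the minimum with \<open>k\<close> keeps every
    value in the palette, and pairs of colors up to \<open>k\<close> remain forbidden.\<close>
  define c :: "nat \<Rightarrow> nat \<Rightarrow> nat"
    where "c v e = min k (if v = 0 then e div 3 + 1 else e mod 3 + 1)" for v e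
  show "local_partition two_squares k c"
    using assms by (auto simp: local_partition_def c_def)
  show "\<not> conflict_colorable two_squares k c"
    unfolding conflict_colorable_def
  proof (intro notI, elim exE conjE)
    fix \<phi> assume \<phi>: "\<forall>v\<in>verts two_squares. \<phi> v \<in> {1..k}"
    assume none: "\<not> (\<exists>e\<in>edges two_squares. \<exists>x y. ends two_squares e = {x, y} \<and>
      \<phi> x = c x e \<and> \<phi> y = c y e)"
    obtain i j where ij: "\<phi> 0 = Suc i" "\<phi> 1 = Suc j" "i < k" "j < k"
      using bspec[OF \<phi>, of 0] bspec[OF \<phi>, of 1] by (cases "\<phi> 0"; cases "\<phi> 1") auto
    define e where "e = 3 * i + j"
    have "e div 3 = i" "e mod 3 = j" "e - 8 = 0" "e < 16"
      using ij assms by (auto simp: e_def)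
    then have "\<phi> 0 = c 0 e" "\<phi> 1 = c 1 e" "ends two_squares e = {0, 1}" "e \<in> edges two_squares"
      using ij by (auto simp: c_def)
    then show False
      using none by blast
  qed
qed

lemma conflict_colorable_two_squares: "conflict_colorable two_squares 4 c"
proof -
  \<comment> \<open>Nine edges forbid at most nine of the sixteen color pairs at vertices 0 and
    1.\<close>
  have "card ((\<lambda>e. (c 0 e, c 1 e)) ` {..<9}) \<le> 9"
    using card_image_le[of "{..<9::nat}"] by simp
  also have "\<dots> < card ({1..4::nat} \<times> {1..4::nat})"
    by simp
  finally have "\<not> {1..4} \<times> {1..4} \<subseteq> (\<lambda>e. (c 0 e, c 1 e)) ` {..<9}"
    using card_mono[of "(\<lambda>e. (c 0 e, c 1 e)) ` {..<9}" "{1..4} \<times> {1..4}"] by auto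
  then obtain c0 c1 where c01: "c0 \<in> {1..4}" "c1 \<in> {1..4}"
      "\<And>e. e < 9 \<Longrightarrow> \<not> (c0 = c 0 e \<and> c1 = c 1 e)"
    by auto blast
  have ex: "\<exists>d\<in>{1..4}. d \<noteq> a \<and> d \<noteq> b" for a b :: nat
    by (rule ex_avoiding) simp
  \<comment> \<open>Each of the edges 9 to 15 is charged to one end, whose color avoids the conflict
    there. Edges 9 and 10 go to vertex 2, edges 13 and 14 to vertex 5, and vertices 3, 4 and 6 get
    one edge each, so these choices are independent.\<close>
  obtain c3 where c3: "c3 \<in> {1..4}" "c3 \<noteq> c 3 11" using ex by blast
  obtain c2 where c2: "c2 \<in> {1..4}" "c2 \<noteq> c 2 9" "c2 \<noteq> c 2 10" using ex by blast
  obtain c4 where c4: "c4 \<in> {1..4}" "c4 \<noteq> c 4 12" using ex by blast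
  obtain c6 where c6: "c6 \<in> {1..4}" "c6 \<noteq> c 6 15" using ex by blast
  obtain c5 where c5: "c5 \<in> {1..4}" "c5 \<noteq> c 5 13" "c5 \<noteq> c 5 14" using ex by blast
  define \<phi> where "\<phi> = (!) [c0, c1, c2, c3, c4, c5, c6]"
  have "\<forall>v<7. \<phi> v \<in> {1..4}"
    using c01 c2 c3 c4 c5 c6 unfolding all_less_7 by (simp add: \<phi>_def)
  moreover have "\<not> (\<phi> (src (e - 8)) = c (src (e - 8)) e \<and> \<phi> (tgt (e - 8)) = c (tgt (e - 8)) e)"
    if "e < 16" for e
  proof (cases "e < 9")
    case True
    then show ?thesis
      using c01(3) by (simp add: \<phi>_def)
  next
    case False
    with that have "e \<in> {9, 10, 11, 12, 13, 14, 15}"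
      by auto
    then show ?thesis
      using c2 c3 c4 c5 c6 by (auto simp: \<phi>_def)
  qed
  ultimately show ?thesis
    unfolding conflict_colorable_def
    by (intro exI[of _ \<phi>]) (auto simp: doubleton_eq_iff)
qed

lemma single_conflict_two_squares: "single_conflict_chromatic_number two_squares = 4"
  unfolding single_conflict_chromatic_number_def
proof (rule Least_equality)
  fix k assume "1 \<le> k \<and> (\<forall>c. local_partition two_squares k c \<longrightarrow> conflict_colorable two_squares k c)"
  then show "4 \<le> k"
    using not_conflict_colorable_two_squares[of k] by fastforce
qed (simp add: conflict_colorable_two_squares)

section \<open>A plane drawing\<close>

text \<open>The unit squares fill opposite quadrants, the fourth and the second, and touch only at
  the origin. The space above the segment from 0 to 1 stays free for the parallel edges.\<close>

definition pos :: "nat \<Rightarrow> complex" where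
  "pos v = [0, 1, Complex 1 (-1), Complex 0 (-1), -1, Complex (-1) 1, Complex 0 1] ! v"

lemma pos_simps [simp]:
  "pos 0 = 0" "pos (Suc 0) = 1" "pos 1 = 1" "pos 2 = Complex 1 (-1)" "pos 3 = Complex 0 (-1)"
  "pos 4 = -1" "pos 5 = Complex (-1) 1" "pos 6 = Complex 0 1"
  by (simp_all add: pos_def)

text \<open>The summand \<open>8 - e\<close> bends the parallel edges into distinct parabolas; by truncation all
  edges \<open>e \<ge> 8\<close> are straight segments.\<close>

definition curve :: "nat \<Rightarrow> real \<Rightarrow> complex" where
  "curve e s = (1 - of_real s) * pos (src (e - 8)) + of_real s * pos (tgt (e - 8))
     + Complex 0 (real (8 - e) * s * (1 - s))"

lemma curve_ends [simp]: "curve e 0 = pos (src (e - 8))" "curve e 1 = pos (tgt (e - 8))"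
  by (simp_all add: curve_def complex_eq_iff)

text \<open>The edges over the index \<open>j\<close> run inside \<open>region j\<close>: for \<open>j = 0\<close> a strip above the segment
  from \<open>0\<close> to \<open>1\<close>, otherwise one of the remaining sides of the two unit squares.\<close>

definition region :: "nat \<Rightarrow> complex set" where
  "region j = {z. [0 \<le> Re z \<and> Re z \<le> 1 \<and> 0 \<le> Im z \<and> (Re z = 0 \<or> Re z = 1 \<longrightarrow> Im z = 0),
     Re z = 1 \<and> -1 \<le> Im z \<and> Im z \<le> 0,
     Im z = -1 \<and> 0 \<le> Re z \<and> Re z \<le> 1,
     Re z = 0 \<and> -1 \<le> Im z \<and> Im z \<le> 0,
     Im z = 0 \<and> -1 \<le> Re z \<and> Re z \<le> 0,
     Re z = -1 \<and> 0 \<le> Im z \<and> Im z \<le> 1,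
     Im z = 1 \<and> -1 \<le> Re z \<and> Re z \<le> 0,
     Re z = 0 \<and> 0 \<le> Im z \<and> Im z \<le> 1] ! j}"

text \<open>Confining the arcs reduces their intersections to a case check on eight fixed sets; only
  the parallel edges must be compared directly.\<close>

lemma curve_in_region:
  assumes "e < 16" "0 \<le> s" "s \<le> 1"
  shows "curve e s \<in> region (e - 8)"
proof (cases "e \<le> 8")
  case True
  with assms show ?thesis
    by (auto simp: curve_def region_def)
next
  case False
  with assms have "e \<in> {9, 10, 11, 12, 13, 14, 15}"
    by auto
  with assms show ?thesis
    by (auto simp: curve_def region_def)
qed

lemma region_Int_pos:
  assumes "j < 8"
  shows "region j \<inter> pos ` {..<7} \<subseteq> pos ` {src j, tgt j}"
proof -
  have "\<forall>v<7. pos v \<in> region j \<longrightarrow> pos v \<in> pos ` {src j, tgt j}"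
    using assms unfolding all_less_7
    by (cases j rule: less_8_cases) (simp_all add: region_def complex_eq_iff)
  then show ?thesis by auto
qed

text \<open>Sides of the squares meet only at common corners. The condition on \<open>Re z\<close>
  being 0 or 1 in \<open>region 0\<close> stops the strip from meeting the vertical sides away from
  its two end points.\<close>

lemma region_Int_region:
  assumes "j < 8" "j' < 8" "j \<noteq> j'"
  shows "region j \<inter> region j' \<subseteq> pos ` ({src j, tgt j} \<inter> {src j', tgt j'})"
proof -
  have *: "region j \<inter> region j' \<subseteq> pos ` ({src j, tgt j} \<inter> {src j', tgt j'})"
    if "j < j'" "j' < 8" for j j'
  proof -
    have "j < 8" using that by simp
    show ?thesis
      by (rule less_8_cases[OF \<open>j < 8\<close>]; rule less_8_cases[OF that(2)])
        (use that(1) in \<open>auto simp: region_def complex_eq_iff\<close>)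
  qed
  show ?thesis
    using *[of j j'] *[of j' j] assms by (cases "j < j'") (auto simp: Int_commute)
qed

text \<open>One coordinate recovers the parameter: the real part is \<open>s\<close> for
  \<open>e \<le> 8\<close>, and the other edges are axis-parallel segments.\<close>

lemma arc_curve:
  assumes "e < 16"
  shows "arc (curve e)"
proof -
  have "continuous_on {0..1} (curve e)"
    unfolding curve_def Complex_eq by (intro continuous_intros)
  moreover have "s = t" if "curve e s = curve e t" for s t
  proof (cases "e \<le> 8")
    case True
    then show ?thesis
      using that by (simp add: curve_def complex_eq_iff)
  next
    case False
    with assms have "e \<in> {9, 10, 11, 12, 13, 14, 15}"
      by auto
    then show ?thesis
      using that by (auto simp: curve_def complex_eq_iff)
  qed
  ultimately show ?thesis
    by (auto simp: arc_def path_def inj_on_def)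
qed

text \<open>Equal real parts give \<open>s = t\<close>. Then the imaginary parts are different
  multiples of \<open>s * (1 - s)\<close>, which must vanish.\<close>

lemma curve_parallel_Int:
  assumes "e \<le> 8" "e' \<le> 8" "e \<noteq> e'" "curve e s = curve e' t"
  shows "s = 0 \<or> s = 1"
proof -
  have "s = t" and "real (8 - e) * s * (1 - s) = real (8 - e') * t * (1 - t)"
    using assms by (auto simp: curve_def complex_eq_iff)
  then have "(real (8 - e) - real (8 - e')) * (s * (1 - s)) = 0"
    by (simp add: algebra_simps)
  moreover have "real (8 - e) - real (8 - e') \<noteq> 0"
    using assms by (simp add: of_nat_diff)
  ultimately show ?thesis by auto
qed

lemma pos_ends_in_path_image: "pos ` ends two_squares e \<subseteq> path_image (curve e)"
  using pathstart_in_path_image[of "curve e"] pathfinish_in_path_image[of "curve e"]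
  by (simp add: pathstart_def pathfinish_def)

lemma plane_drawing_two_squares: "plane_drawing two_squares pos curve"
  unfolding plane_drawing_def
proof (intro conjI ballI impI)
  show "inj_on pos (verts two_squares)"
  proof -
    have "\<forall>v<7. \<forall>w<7. pos v = pos w \<longrightarrow> v = w"
      unfolding all_less_7 by (simp add: complex_eq_iff)
    then show ?thesis by (auto simp: inj_on_def)
  qed
next
  fix e assume "e \<in> edges two_squares"
  then have e: "e < 16" "e - 8 < 8" by auto
  show "arc (curve e)"
    using e by (simp add: arc_curve)
  show "{pathstart (curve e), pathfinish (curve e)} = pos ` ends two_squares e"
    by (simp add: pathstart_def pathfinish_def)
  have "path_image (curve e) \<subseteq> region (e - 8)"
    using e curve_in_region by (auto simp: path_image_def)
  moreover have "src (e - 8) < 7 \<and> tgt (e - 8) < 7"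
    using e(2) by (cases "e - 8" rule: less_8_cases) simp_all
  ultimately show "path_image (curve e) \<inter> pos ` verts two_squares = pos ` ends two_squares e"
    using region_Int_pos[OF e(2)] pos_ends_in_path_image[of e] by auto
next
  fix e e' assume "e \<in> edges two_squares" "e' \<in> edges two_squares" and ne: "e \<noteq> e'"
  then have e: "e < 16" "e - 8 < 8" and e': "e' < 16" "e' - 8 < 8" by auto
  show "path_image (curve e) \<inter> path_image (curve e')
    = pos ` (ends two_squares e \<inter> ends two_squares e')"
  proof
    show "pos ` (ends two_squares e \<inter> ends two_squares e')
        \<subseteq> path_image (curve e) \<inter> path_image (curve e')"
      using pos_ends_in_path_image by blast
    show "path_image (curve e) \<inter> path_image (curve e')
        \<subseteq> pos ` (ends two_squares e \<inter> ends two_squares e')"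
    proof (cases "e - 8 = e' - 8")
      case True
      \<comment> \<open>Truncated differences of distinct numbers agree only when both are
        0.\<close>
      with ne have "e \<le> 8" "e' \<le> 8" by auto
      with ne show ?thesis
        using curve_parallel_Int[of e e'] by (fastforce simp: path_image_def)
    next
      case False
      then show ?thesis
        using region_Int_region[OF e(2) e'(2)] curve_in_region[OF e(1)] curve_in_region[OF e'(1)]
        by (fastforce simp: path_image_def)
    qed
  qed
qed

theorem theorem4p3:
  "\<exists>G :: (nat, nat) mgraph. multigraph G \<and> planar G \<and>
     (ch_sep G, ch_ad G, single_conflict_chromatic_number G) = (3, 3, 4)"
proof (intro exI conjI)
  show "multigraph two_squares"
    by (rule multigraph_two_squares)
  show "planar two_squares"
    using plane_drawing_two_squares unfolding planar_def by blast
  show "(ch_sep two_squares, ch_ad two_squares, single_conflict_chromatic_number two_squares)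
      = (3, 3, 4)"
    using ch_sep_ch_ad_eqI[OF multigraph_two_squares choosable_two_squares
        not_sep_choosable_two_squares] single_conflict_two_squares
    by simp
qed

end
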